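(* Let $(A,m,\bullet,\Delta)$ be a Com-PreLie bialgebra over a field $\mathbb{K}$ of characteristic zero such that the bialgebra $(A,m,\Delta)$ is conilpotent (hence a Hopf algebra), and let $S$ be its antipode. Then for all $a,b\in A$, \[S(a\bullet b)=\left(S(a)\bullet b^{(1)}\right)S\left(b^{(2)}\right),\] where $\Delta(b)=b^{(1)}\otimes b^{(2)}$ in Sweedler's notation.
   Context: A (right) Com-PreLie algebra is a vector space $A$ with two bilinear products, $m:(a,b)\mapsto ab$ and $\bullet$, such that $m$ is commutative and associative, $\bullet$ satisfies the right preLie identity $(a\bullet b)\bullet c-a\bullet(b\bullet c)=(a\bullet c)\bullet b-a\bullet(c\bullet b)$, and the Leibniz identity $(ab)\bullet c=(a\bullet c)b+a(b\bullet c)$ holds for all $a,b,c\in A$. A Com-PreLie bialgebra is a family $(A,m,\bullet,\Delta)$ such that $(A,m,\bullet)$ is a Com-PreLie algebra with $(A,m)$ unitary, $(A,m,\Delta)$ is a bialgebra, and for all $a,b\in A$, $\Delta(a\bullet b)=a^{(1)}\otimes a^{(2)}\bullet b+a^{(1)}\bullet b^{(1)}\otimes a^{(2)}b^{(2)}$ (Sweedler's notation). With counit $\varepsilon$, let $A_+=\ker\varepsilon$ and $\tilde\Delta(a)=\Delta(a)-a\otimes 1-1\otimes a$ for $a\in A_+$, with iterates $\tilde\Delta^{(0)}=\mathrm{Id}$, $\tilde\Delta^{(n)}=(\tilde\Delta\otimes\mathrm{Id}^{\otimes(n-1)})\circ\tilde\Delta^{(n-1)}$. The bialgebra is conilpotent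 if for every $a\in A_+$ there is $N\ge1$ with $\tilde\Delta^{(N)}(a)=0$. *)

theory Defs
  imports Complex_Main "HOL-Library.Poly_Mapping"
begin

text \<open>
  The underlying space of a \<open>K\<close>-algebra \<open>A\<close> is a whole type, its scalar multiplication is an
  explicit argument \<open>scale\<close>, and its ring structure comes from a type class.

  The tensor power of \<open>A\<close> of degree \<open>n\<close> is the quotient \<open>F n / R n\<close>, where \<open>F n\<close> is the vector
  space with basis the words (lists) of length \<open>n\<close> over \<open>A\<close> and \<open>R n\<close> is the subspace spanned by
  the multilinearity relations. A tensor is a coset of \<open>R n\<close>, and equality of tensors is equality
  of cosets.
\<close>

type_synonym ('a, 'k) words = "'a list \<Rightarrow>\<^sub>0 'k"
type_synonym ('a, 'k) tensor = "('a, 'k) words set"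

definition word :: "'a list \<Rightarrow> ('a, 'k::field) words" where
  "word w = Poly_Mapping.single w 1"

definition word_scale :: "'k::field \<Rightarrow> ('a, 'k) words \<Rightarrow> ('a, 'k) words" where
  "word_scale c p = Poly_Mapping.map (\<lambda>x. c * x) p"

lemma lookup_word_scale [simp]:
  "Poly_Mapping.lookup (word_scale c p) w = c * Poly_Mapping.lookup p w"
  by (simp add: word_scale_def Poly_Mapping.map.rep_eq when_def)

lemma vector_space_word_scale: "vector_space word_scale"
  by unfold_locales (auto intro!: poly_mapping_eqI simp: lookup_add algebra_simps)

definition lin_ext ::
    "('k::field \<Rightarrow> 'v \<Rightarrow> 'v) \<Rightarrow> ('a list \<Rightarrow> 'v::ab_group_add) \<Rightarrow> ('a, 'k) words \<Rightarrow> 'v" where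
  "lin_ext s f p = (\<Sum>w\<in>Poly_Mapping.keys p. s (Poly_Mapping.lookup p w) (f w))"

definition tensor_relations ::
    "('k::field \<Rightarrow> 'a::ab_group_add \<Rightarrow> 'a) \<Rightarrow> nat \<Rightarrow> ('a, 'k) words set" where
  "tensor_relations scale n =
     {word (u @ [x + y] @ v) - word (u @ [x] @ v) - word (u @ [y] @ v) | u v x y.
        length u + length v + 1 = n} \<union>
     {word (u @ [scale c x] @ v) - word_scale c (word (u @ [x] @ v)) | u v c x.
        length u + length v + 1 = n}"

definition tensor_null ::
    "('k::field \<Rightarrow> 'a::ab_group_add \<Rightarrow> 'a) \<Rightarrow> nat \<Rightarrow> ('a, 'k) words set" where
  "tensor_null scale n = module.span word_scale (tensor_relations scale n)"

definition tensor_class ::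
    "('k::field \<Rightarrow> 'a::ab_group_add \<Rightarrow> 'a) \<Rightarrow> nat \<Rightarrow> ('a, 'k) words \<Rightarrow> ('a, 'k) tensor" where
  "tensor_class scale n p = {q. q - p \<in> tensor_null scale n}"

definition tensor_power ::
    "('k::field \<Rightarrow> 'a::ab_group_add \<Rightarrow> 'a) \<Rightarrow> nat \<Rightarrow> ('a, 'k) tensor set" where
  "tensor_power scale n =
     tensor_class scale n ` {p. \<forall>w\<in>Poly_Mapping.keys p. length w = n}"

definition tensor_rep :: "('a, 'k::field) tensor \<Rightarrow> ('a, 'k) words" where
  "tensor_rep X = (SOME p. p \<in> X)"

definition pure ::
    "('k::field \<Rightarrow> 'a::ab_group_add \<Rightarrow> 'a) \<Rightarrow> 'a list \<Rightarrow> ('a, 'k) tensor" where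
  "pure scale w = tensor_class scale (length w) (word w)"

definition tensor_zero ::
    "('k::field \<Rightarrow> 'a::ab_group_add \<Rightarrow> 'a) \<Rightarrow> nat \<Rightarrow> ('a, 'k) tensor" where
  "tensor_zero scale n = tensor_class scale n 0"

definition tensor_add ::
    "('k::field \<Rightarrow> 'a::ab_group_add \<Rightarrow> 'a) \<Rightarrow> nat
      \<Rightarrow> ('a, 'k) tensor \<Rightarrow> ('a, 'k) tensor \<Rightarrow> ('a, 'k) tensor" where
  "tensor_add scale n X Y = tensor_class scale n (tensor_rep X + tensor_rep Y)"

definition tensor_diff ::
    "('k::field \<Rightarrow> 'a::ab_group_add \<Rightarrow> 'a) \<Rightarrow> nat
      \<Rightarrow> ('a, 'k) tensor \<Rightarrow> ('a, 'k) tensor \<Rightarrow> ('a, 'k) tensor" where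
  "tensor_diff scale n X Y = tensor_class scale n (tensor_rep X - tensor_rep Y)"

definition tensor_scale ::
    "('k::field \<Rightarrow> 'a::ab_group_add \<Rightarrow> 'a) \<Rightarrow> nat
      \<Rightarrow> 'k \<Rightarrow> ('a, 'k) tensor \<Rightarrow> ('a, 'k) tensor" where
  "tensor_scale scale n c X = tensor_class scale n (word_scale c (tensor_rep X))"

text \<open>
  \<open>tensor_map scale m f\<close> and \<open>tensor_eval scale f\<close> are the linear maps induced on a tensor power
  by a multilinear map \<open>f\<close> with values in the tensor power of degree \<open>m\<close>, respectively in \<open>A\<close>.
  They are meant for multilinear \<open>f\<close> only; then they do not depend on the representatives.
\<close>

definition tensor_map ::
    "('k::field \<Rightarrow> 'a::ab_group_add \<Rightarrow> 'a) \<Rightarrow> nat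
      \<Rightarrow> ('a list \<Rightarrow> ('a, 'k) tensor) \<Rightarrow> ('a, 'k) tensor \<Rightarrow> ('a, 'k) tensor" where
  "tensor_map scale m f X =
     tensor_class scale m (lin_ext word_scale (\<lambda>w. tensor_rep (f w)) (tensor_rep X))"

definition tensor_eval ::
    "('k::field \<Rightarrow> 'a::ab_group_add \<Rightarrow> 'a) \<Rightarrow> ('a list \<Rightarrow> 'a) \<Rightarrow> ('a, 'k) tensor \<Rightarrow> 'a" where
  "tensor_eval scale f X = lin_ext scale f (tensor_rep X)"

text \<open>
  Sweedler's notation: if \<open>X = \<Delta>(a)\<close>, then \<open>sweedler scale X (\<lambda>x y. e x y)\<close> is the sum
  written \<open>e(a', a'')\<close> with \<open>\<Delta>(a) = a' \<otimes> a''\<close>, for an \<open>A\<close>-valued bilinear expression \<open>e\<close>, and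
  \<open>sweedler_tensor scale m X (\<lambda>x y. e x y)\<close> is the same for a bilinear expression with values
  in the tensor power of degree \<open>m\<close>.
\<close>

definition sweedler ::
    "('k::field \<Rightarrow> 'a::ab_group_add \<Rightarrow> 'a) \<Rightarrow> ('a, 'k) tensor \<Rightarrow> ('a \<Rightarrow> 'a \<Rightarrow> 'a) \<Rightarrow> 'a" where
  "sweedler scale X e = tensor_eval scale (\<lambda>w. e (w ! 0) (w ! 1)) X"

definition sweedler_tensor ::
    "('k::field \<Rightarrow> 'a::ab_group_add \<Rightarrow> 'a) \<Rightarrow> nat \<Rightarrow> ('a, 'k) tensor
      \<Rightarrow> ('a \<Rightarrow> 'a \<Rightarrow> ('a, 'k) tensor) \<Rightarrow> ('a, 'k) tensor" where
  "sweedler_tensor scale m X e = tensor_map scale m (\<lambda>w. e (w ! 0) (w ! 1)) X"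

locale com_algebra = vector_space scale
  for scale :: "'k::field \<Rightarrow> 'a::comm_ring \<Rightarrow> 'a" +
  assumes scale_mult_left: "scale c a * b = scale c (a * b)"

locale com_prelie_algebra = com_algebra scale
  for scale :: "'k::field \<Rightarrow> 'a::comm_ring \<Rightarrow> 'a" +
  fixes pl :: "'a \<Rightarrow> 'a \<Rightarrow> 'a"  (infixl \<open>\<bullet>\<close> 70)
  assumes pl_linear_left: "Vector_Spaces.linear scale scale (\<lambda>a. a \<bullet> b)"
    and pl_linear_right: "Vector_Spaces.linear scale scale (\<lambda>b. a \<bullet> b)"
    and right_prelie: "(a \<bullet> b) \<bullet> c - a \<bullet> (b \<bullet> c) = (a \<bullet> c) \<bullet> b - a \<bullet> (c \<bullet> b)"
    and leibniz: "(a * b) \<bullet> c = (a \<bullet> c) * b + a * (b \<bullet> c)"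

text \<open>A bialgebra whose product is commutative, with counit \<open>\<epsilon>\<close>.\<close>

locale com_bialgebra = com_algebra scale
  for scale :: "'k::field \<Rightarrow> 'a::comm_ring_1 \<Rightarrow> 'a" +
  fixes \<Delta> :: "'a \<Rightarrow> ('a, 'k) tensor" and \<epsilon> :: "'a \<Rightarrow> 'k"
  assumes Delta_in: "\<Delta> a \<in> tensor_power scale 2"
    and Delta_add: "\<Delta> (a + b) = tensor_add scale 2 (\<Delta> a) (\<Delta> b)"
    and Delta_scale: "\<Delta> (scale c a) = tensor_scale scale 2 c (\<Delta> a)"
    and counit_linear: "Vector_Spaces.linear scale (*) \<epsilon>"
    and coassoc:
      "sweedler_tensor scale 3 (\<Delta> a) (\<lambda>x y.
         sweedler_tensor scale 3 (\<Delta> x) (\<lambda>x' x''. pure scale [x', x'', y])) =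
       sweedler_tensor scale 3 (\<Delta> a) (\<lambda>x y.
         sweedler_tensor scale 3 (\<Delta> y) (\<lambda>y' y''. pure scale [x, y', y'']))"
    and counit_left: "sweedler scale (\<Delta> a) (\<lambda>x y. scale (\<epsilon> x) y) = a"
    and counit_right: "sweedler scale (\<Delta> a) (\<lambda>x y. scale (\<epsilon> y) x) = a"
    and Delta_mult:
      "\<Delta> (a * b) =
       sweedler_tensor scale 2 (\<Delta> a) (\<lambda>x y.
         sweedler_tensor scale 2 (\<Delta> b) (\<lambda>z t. pure scale [x * z, y * t]))"
    and Delta_one: "\<Delta> 1 = pure scale [1, 1]"
    and counit_mult: "\<epsilon> (a * b) = \<epsilon> a * \<epsilon> b"
    and counit_one: "\<epsilon> 1 = 1"

locale com_prelie_bialgebra = com_prelie_algebra scale pl + com_bialgebra scale \<Delta> \<epsilon>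
  for scale :: "'k::field \<Rightarrow> 'a::comm_ring_1 \<Rightarrow> 'a"
    and pl :: "'a \<Rightarrow> 'a \<Rightarrow> 'a"  (infixl \<open>\<bullet>\<close> 70)
    and \<Delta> :: "'a \<Rightarrow> ('a, 'k) tensor" and \<epsilon> :: "'a \<Rightarrow> 'k" +
  assumes Delta_pl:
    "\<Delta> (a \<bullet> b) =
     tensor_add scale 2
       (sweedler_tensor scale 2 (\<Delta> a) (\<lambda>x y. pure scale [x, y \<bullet> b]))
       (sweedler_tensor scale 2 (\<Delta> a) (\<lambda>x y.
          sweedler_tensor scale 2 (\<Delta> b) (\<lambda>z t. pure scale [x \<bullet> z, y * t])))"

text \<open>
  The formula for the reduced coproduct is used on all of \<open>A\<close>, not only on the kernel of the
  counit. Tensor powers of that kernel embed into those of \<open>A\<close>, so on elements of the kernel the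
  iterates are the usual ones. \<open>reduced_iter scale \<Delta> n a\<close> has degree \<open>n + 1\<close>; the step from \<open>n\<close>
  to \<open>n + 1\<close> applies the reduced coproduct to the first tensor factor.
\<close>

definition reduced_coproduct ::
    "('k::field \<Rightarrow> 'a::comm_ring_1 \<Rightarrow> 'a) \<Rightarrow> ('a \<Rightarrow> ('a, 'k) tensor) \<Rightarrow> 'a \<Rightarrow> ('a, 'k) tensor" where
  "reduced_coproduct scale \<Delta> a =
     tensor_diff scale 2 (tensor_diff scale 2 (\<Delta> a) (pure scale [a, 1])) (pure scale [1, a])"

primrec reduced_iter ::
    "('k::field \<Rightarrow> 'a::comm_ring_1 \<Rightarrow> 'a) \<Rightarrow> ('a \<Rightarrow> ('a, 'k) tensor)
      \<Rightarrow> nat \<Rightarrow> 'a \<Rightarrow> ('a, 'k) tensor" where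
  "reduced_iter scale \<Delta> 0 a = pure scale [a]"
| "reduced_iter scale \<Delta> (Suc n) a =
     tensor_map scale (n + 2)
       (\<lambda>w. sweedler_tensor scale (n + 2) (reduced_coproduct scale \<Delta> (hd w))
              (\<lambda>x y. pure scale (x # y # tl w)))
       (reduced_iter scale \<Delta> n a)"

definition conilpotent ::
    "('k::field \<Rightarrow> 'a::comm_ring_1 \<Rightarrow> 'a) \<Rightarrow> ('a \<Rightarrow> ('a, 'k) tensor) \<Rightarrow> ('a \<Rightarrow> 'k) \<Rightarrow> bool" where
  "conilpotent scale \<Delta> \<epsilon> \<longleftrightarrow>
     (\<forall>a. \<epsilon> a = 0 \<longrightarrow> (\<exists>N\<ge>1. reduced_iter scale \<Delta> N a = tensor_zero scale (N + 1)))"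

text \<open>The antipode is the convolution inverse of the identity.\<close>

definition is_antipode ::
    "('k::field \<Rightarrow> 'a::comm_ring_1 \<Rightarrow> 'a) \<Rightarrow> ('a \<Rightarrow> ('a, 'k) tensor) \<Rightarrow> ('a \<Rightarrow> 'k)
      \<Rightarrow> ('a \<Rightarrow> 'a) \<Rightarrow> bool" where
  "is_antipode scale \<Delta> \<epsilon> S \<longleftrightarrow>
     Vector_Spaces.linear scale scale S \<and>
     (\<forall>a. sweedler scale (\<Delta> a) (\<lambda>x y. S x * y) = scale (\<epsilon> a) 1) \<and>
     (\<forall>a. sweedler scale (\<Delta> a) (\<lambda>x y. x * S y) = scale (\<epsilon> a) 1)"

end

theory Submission
  imports Defs
begin

text \<open>
  Applying \<open>m \<circ> (Id \<otimes> S) \<circ> \<Delta>\<close> to \<open>a \<bullet> b\<close>, whose counit vanishes, gives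
  \<open>a' S(a'' \<bullet> b) = - (a' \<bullet> b') S(a'') S(b'')\<close>, and convolving with \<open>S\<close> in the variable \<open>a\<close> yields
  \<open>S(a \<bullet> b) = - S(a') (a'' \<bullet> b') S(a''') S(b'')\<close>. Since \<open>1 \<bullet> c = 0\<close>, applying \<open>- \<bullet> c\<close> to
  \<open>S(a') a'' = \<epsilon>(a) 1\<close> and using the Leibniz identity gives \<open>- S(a') (a'' \<bullet> c) = (S(a') \<bullet> c) a''\<close>;
  substituting this, \<open>a'' S(a''')\<close> cancels.
\<close>

section \<open>Evaluation of tensors by multilinear maps\<close>

text \<open>The keys of a sum or of a multiple may shrink by cancellation. Summing over a fixed
  finite superset lets \<open>lin_ext\<close> be compared across different words, since the extra
  coefficients are zero.\<close>

lemma lin_ext_superset: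
  fixes s :: "'k::field \<Rightarrow> 'v::ab_group_add \<Rightarrow> 'v"
  assumes "vector_space s" "finite W" "Poly_Mapping.keys p \<subseteq> W"
  shows "lin_ext s f p = (\<Sum>w\<in>W. s (Poly_Mapping.lookup p w) (f w))"
proof -
  interpret vector_space s by fact
  show ?thesis unfolding lin_ext_def
    by (rule sum.mono_neutral_left) (use assms in \<open>auto simp: in_keys_iff\<close>)
qed

lemma linear_lin_ext:
  fixes s :: "'k::field \<Rightarrow> 'v::ab_group_add \<Rightarrow> 'v"
  assumes "vector_space s"
  shows "Vector_Spaces.linear word_scale s (lin_ext s f)"
proof -
  interpret vector_space s by fact
  have "lin_ext s f (p + q) = lin_ext s f p + lin_ext s f q" for p q
  proof -
    let ?W = "Poly_Mapping.keys p \<union> Poly_Mapping.keys q"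
    have "Poly_Mapping.keys (p + q) \<subseteq> ?W"
      by (rule Poly_Mapping.keys_add)
    then show ?thesis
      by (simp add: lin_ext_superset[OF assms, of ?W] lookup_add scale_left_distrib sum.distrib)
  qed
  moreover have "lin_ext s f (word_scale c p) = s c (lin_ext s f p)" for c p
  proof -
    have "Poly_Mapping.keys (word_scale c p) \<subseteq> Poly_Mapping.keys p"
      by (auto simp: in_keys_iff)
    then show ?thesis
      by (simp add: lin_ext_superset[OF assms, of "Poly_Mapping.keys p"] scale_sum_right)
  qed
  ultimately show ?thesis
    by (simp add: Vector_Spaces.linear_iff vector_space_word_scale assms)
qed

lemma lin_ext_word:
  assumes "vector_space s"
  shows "lin_ext s f (word w) = f w"
proof -
  interpret vector_space s by fact
  show ?thesis by (simp add: lin_ext_def word_def)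
qed

text \<open>The active slot is marked by the same splitting into \<open>u\<close> and
  \<open>v\<close> as in \<open>tensor_relations\<close>, so that linearity in that slot kills
  exactly those generators. Words of other lengths are unconstrained.\<close>

definition multilinear ::
    "('k::field \<Rightarrow> 'a::ab_group_add \<Rightarrow> 'a) \<Rightarrow> nat \<Rightarrow> ('a list \<Rightarrow> 'a) \<Rightarrow> bool" where
  "multilinear scale n f \<longleftrightarrow>
     (\<forall>u v. length u + length v + 1 = n \<longrightarrow> Vector_Spaces.linear scale scale (\<lambda>x. f (u @ [x] @ v)))"

lemma lin_ext_tensor_null:
  assumes "vector_space scale" "multilinear scale n f" "p \<in> tensor_null scale n"
  shows "lin_ext scale f p = 0"
proof -
  interpret L: Vector_Spaces.linear word_scale scale "lin_ext scale f"
    by (rule linear_lin_ext) fact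
  have "module word_scale"
    using vector_space_word_scale by (simp add: vector_space_def module_def)
  have "lin_ext scale f r = 0" if "r \<in> tensor_relations scale n" for r
    using that assms(2)
    by (auto simp: tensor_relations_def L.diff L.scale lin_ext_word[OF assms(1)] multilinear_def
        Vector_Spaces.linear_iff)
  then show ?thesis
    using L.eq_0_on_span[of "tensor_relations scale n" p] assms(3)
    unfolding tensor_null_def by blast
qed

text \<open>The representative chosen by \<open>tensor_rep\<close> differs from \<open>p\<close> by
  an element of \<open>tensor_null\<close>, on which the extension of a multilinear map
  vanishes.\<close>

lemma tensor_eval_class:
  assumes "vector_space scale" "multilinear scale n f"
  shows "tensor_eval scale f (tensor_class scale n p) = lin_ext scale f p"
proof -
  interpret L: Vector_Spaces.linear word_scale scale "lin_ext scale f"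
    by (rule linear_lin_ext) fact
  have "p \<in> tensor_class scale n p"
    by (simp add: tensor_class_def tensor_null_def L.vs1.span_zero)
  then have "tensor_rep (tensor_class scale n p) \<in> tensor_class scale n p"
    unfolding tensor_rep_def by (rule someI)
  then have "tensor_rep (tensor_class scale n p) - p \<in> tensor_null scale n"
    by (simp add: tensor_class_def)
  then have "lin_ext scale f (tensor_rep (tensor_class scale n p) - p) = 0"
    by (rule lin_ext_tensor_null[OF assms])
  then show ?thesis
    by (simp add: tensor_eval_def L.diff)
qed

lemma tensor_eval_pure:
  assumes "vector_space scale" "multilinear scale (length w) f"
  shows "tensor_eval scale f (pure scale w) = f w"
  using assms by (simp add: pure_def tensor_eval_class lin_ext_word)

lemma tensor_eval_add:
  assumes "vector_space scale" "multilinear scale n f"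
  shows "tensor_eval scale f (tensor_add scale n X Y) = tensor_eval scale f X + tensor_eval scale f Y"
proof -
  interpret L: Vector_Spaces.linear word_scale scale "lin_ext scale f"
    by (rule linear_lin_ext) fact
  \<comment> \<open>\<open>tensor_eval_def\<close> is unfolded only in the second pass: unfolded
    earlier, it would keep \<open>tensor_eval_class\<close> from matching.\<close>
  show ?thesis
    using assms by (simp add: tensor_add_def tensor_eval_class L.add) (simp add: tensor_eval_def)
qed

lemma tensor_eval_scale:
  assumes "vector_space scale" "multilinear scale n f"
  shows "tensor_eval scale f (tensor_scale scale n c X) = scale c (tensor_eval scale f X)"
proof -
  interpret L: Vector_Spaces.linear word_scale scale "lin_ext scale f"
    by (rule linear_lin_ext) fact
  show ?thesis
    using assms by (simp add: tensor_scale_def tensor_eval_class L.scale) (simp add: tensor_eval_def)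
qed

text \<open>Both sides expand over the same representative of \<open>X\<close>, so only linearity of
  \<open>lin_ext scale f\<close> enters. This turns the tensor equations \<open>coassoc\<close>,
  \<open>Delta_mult\<close> and \<open>Delta_pl\<close> into equations in the algebra.\<close>

lemma tensor_eval_sweedler_tensor:
  assumes "vector_space scale" "multilinear scale m f"
  shows "tensor_eval scale f (sweedler_tensor scale m X e) =
    sweedler scale X (\<lambda>x y. tensor_eval scale f (e x y))"
proof -
  interpret L: Vector_Spaces.linear word_scale scale "lin_ext scale f"
    by (rule linear_lin_ext) fact
  have "lin_ext scale f (lin_ext word_scale g p) = lin_ext scale (\<lambda>w. lin_ext scale f (g w)) p"
    for g :: "'b list \<Rightarrow> ('b, 'a) words" and p
    by (simp add: lin_ext_def[of word_scale] lin_ext_def[of _ _ p] L.sum L.scale)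
  then show ?thesis
    using assms
    by (simp add: sweedler_tensor_def sweedler_def tensor_map_def tensor_eval_class)
      (simp add: tensor_eval_def)
qed

lemma linear_sweedler:
  assumes "Vector_Spaces.linear scale scale f"
  shows "f (sweedler scale X e) = sweedler scale X (\<lambda>x y. f (e x y))"
proof -
  interpret Vector_Spaces.linear scale scale f by fact
  show ?thesis
    by (simp add: sweedler_def tensor_eval_def lin_ext_def sum scale)
qed

section \<open>Sweedler calculus\<close>

definition bilinear ::
    "('k::field \<Rightarrow> 'a::ab_group_add \<Rightarrow> 'a) \<Rightarrow> ('a \<Rightarrow> 'a \<Rightarrow> 'a) \<Rightarrow> bool" where
  "bilinear scale e \<longleftrightarrow>
     (\<forall>y. Vector_Spaces.linear scale scale (\<lambda>x. e x y)) \<and>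
     (\<forall>x. Vector_Spaces.linear scale scale (e x))"

lemma bilinearI:
  assumes "\<And>y. Vector_Spaces.linear scale scale (\<lambda>x. e x y)"
    and "\<And>x. Vector_Spaces.linear scale scale (\<lambda>y. e x y)"
  shows "bilinear scale e"
  using assms by (simp add: bilinear_def)

lemma multilinear_2:
  fixes scale :: "'k::field \<Rightarrow> 'a::ab_group_add \<Rightarrow> 'a"
  assumes "bilinear scale e"
  shows "multilinear scale 2 (\<lambda>w. e (w ! 0) (w ! 1))"
  unfolding multilinear_def
proof (intro allI impI)
  fix u v :: "'a list"
  assume "length u + length v + 1 = 2"
  then consider a where "u = [a]" "v = []" | a where "u = []" "v = [a]"
    by (cases u; cases v) (auto simp: length_Suc_conv)
  then show "Vector_Spaces.linear scale scale
      (\<lambda>x. e ((u @ [x] @ v) ! 0) ((u @ [x] @ v) ! 1))"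
    using assms by cases (auto simp: bilinear_def)
qed

lemma multilinear_3:
  fixes scale :: "'k::field \<Rightarrow> 'a::ab_group_add \<Rightarrow> 'a"
  assumes "\<And>y z. Vector_Spaces.linear scale scale (\<lambda>x. f x y z)"
    and "\<And>x z. Vector_Spaces.linear scale scale (\<lambda>y. f x y z)"
    and "\<And>x y. Vector_Spaces.linear scale scale (\<lambda>z. f x y z)"
  shows "multilinear scale 3 (\<lambda>w. f (w ! 0) (w ! 1) (w ! 2))"
  unfolding multilinear_def
proof (intro allI impI)
  fix u v :: "'a list"
  assume "length u + length v + 1 = 3"
  then have "length u + length v = 2" by simp
  then consider a b where "u = []" "v = [a, b]" | a b where "u = [a]" "v = [b]"
    | a b where "u = [a, b]" "v = []"
    by (cases u; cases v; cases "tl u"; cases "tl v") auto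
  then show "Vector_Spaces.linear scale scale
      (\<lambda>x. f ((u @ [x] @ v) ! 0) ((u @ [x] @ v) ! 1) ((u @ [x] @ v) ! 2))"
    using assms by cases auto
qed

context com_bialgebra
begin

abbreviation lin :: "('a \<Rightarrow> 'a) \<Rightarrow> bool" where
  "lin f \<equiv> Vector_Spaces.linear scale scale f"

abbreviation sw :: "'a \<Rightarrow> ('a \<Rightarrow> 'a \<Rightarrow> 'a) \<Rightarrow> 'a" where
  "sw a e \<equiv> sweedler scale (\<Delta> a) e"

lemma scale_mult_right: "a * scale c b = scale c (a * b)"
  by (metis mult.commute scale_mult_left)

lemma linI:
  assumes "\<And>x y. f (x + y) = f x + f y" "\<And>c x. f (scale c x) = scale c (f x)"
  shows "lin f"
  using assms by (simp add: Vector_Spaces.linear_iff vector_space_axioms)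

lemma lin_add: "lin f \<Longrightarrow> f (x + y) = f x + f y"
  by (simp add: Vector_Spaces.linear_iff)

lemma lin_scale: "lin f \<Longrightarrow> f (scale c x) = scale c (f x)"
  by (simp add: Vector_Spaces.linear_iff)

lemma counit_add: "\<epsilon> (x + y) = \<epsilon> x + \<epsilon> y"
  and counit_scale: "\<epsilon> (scale c x) = c * \<epsilon> x"
  using counit_linear by (simp_all add: Vector_Spaces.linear_iff)

lemma lin_id: "lin (\<lambda>x. x)"
  by (rule linI) auto

lemma lin_mult_right: "lin f \<Longrightarrow> lin (\<lambda>x. f x * c)"
  by (rule linI) (auto simp: Vector_Spaces.linear_iff distrib_right scale_mult_left)

lemma lin_mult_left: "lin f \<Longrightarrow> lin (\<lambda>x. c * f x)"
  using lin_mult_right[of f c] by (simp add: mult.commute[of c])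

lemma lin_minus: "lin f \<Longrightarrow> lin (\<lambda>x. - f x)"
  by (rule linI) (auto simp: Vector_Spaces.linear_iff)

lemma lin_const_scale: "lin f \<Longrightarrow> lin (\<lambda>x. scale c (f x))"
  by (rule linI) (auto simp: Vector_Spaces.linear_iff scale_right_distrib mult.commute)

lemma lin_scale_counit: "lin f \<Longrightarrow> lin (\<lambda>x. scale (\<epsilon> (f x)) c)"
  by (rule linI) (auto simp: Vector_Spaces.linear_iff counit_add counit_scale scale_left_distrib)

lemma lin_comp: "lin g \<Longrightarrow> lin f \<Longrightarrow> lin (\<lambda>x. g (f x))"
  by (rule linI) (auto simp: Vector_Spaces.linear_iff)

text \<open>The representative of the coproduct changes with the argument, and bilinearity of
  \<open>e\<close> makes the value independent of it.\<close>

lemma lin_sweedler: "bilinear scale e \<Longrightarrow> lin f \<Longrightarrow> lin (\<lambda>a. sw (f a) e)"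
  by (rule linI)
    (auto simp: Vector_Spaces.linear_iff Delta_add Delta_scale sweedler_def multilinear_2
      simp del: One_nat_def
      intro: tensor_eval_add[OF vector_space_axioms] tensor_eval_scale[OF vector_space_axioms])

text \<open>Here the tensor is fixed and the expression varies, so one representative serves
  throughout and linearity is checked summand by summand.\<close>

lemma lin_sweedler_parameter:
  assumes "\<And>x y. lin (\<lambda>a. g a x y)"
  shows "lin (\<lambda>a. sweedler scale X (g a))"
proof (rule linI)
  show "sweedler scale X (g (a + b)) = sweedler scale X (g a) + sweedler scale X (g b)" for a b
    by (simp add: lin_add[OF assms] sweedler_def tensor_eval_def lin_ext_def scale_right_distrib
        sum.distrib)
  show "sweedler scale X (g (scale c a)) = scale c (sweedler scale X (g a))" for c a
    by (simp add: lin_scale[OF assms] sweedler_def tensor_eval_def lin_ext_def scale_sum_right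
        mult.commute)
qed

text \<open>Rearranging Sweedler sums creates multilinearity obligations; these rules discharge them
  by descending through the expression.\<close>

lemmas lin_intros = bilinearI lin_id lin_mult_right lin_mult_left lin_minus lin_const_scale
  lin_scale_counit lin_sweedler lin_sweedler_parameter

lemma sweedler_mult_left: "c * sweedler scale X e = sweedler scale X (\<lambda>x y. c * e x y)"
  by (rule linear_sweedler) (intro lin_intros)

lemma sweedler_mult_right: "sweedler scale X e * c = sweedler scale X (\<lambda>x y. e x y * c)"
  by (rule linear_sweedler[of _ "\<lambda>u. u * c"]) (intro lin_intros)

lemma sweedler_uminus: "- sweedler scale X e = sweedler scale X (\<lambda>x y. - e x y)"
  by (rule linear_sweedler) (intro lin_intros)

lemma sweedler_add:
  "sweedler scale X (\<lambda>x y. e x y + e' x y) = sweedler scale X e + sweedler scale X e'"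
  by (simp add: sweedler_def tensor_eval_def lin_ext_def scale_right_distrib sum.distrib)

lemma sweedler_swap:
  "sweedler scale X (\<lambda>x y. sweedler scale Y (\<lambda>z t. e x y z t)) =
   sweedler scale Y (\<lambda>z t. sweedler scale X (\<lambda>x y. e x y z t))"
  unfolding sweedler_def tensor_eval_def lin_ext_def
  by (simp add: scale_sum_right mult.commute) (rule sum.swap)

text \<open>Apply to both sides of \<open>coassoc\<close> the linear map on the third tensor power
  induced by the trilinear map \<open>f\<close>.\<close>

lemma sweedler_coassoc:
  assumes "\<And>y z. lin (\<lambda>x. f x y z)" "\<And>x z. lin (\<lambda>y. f x y z)" "\<And>x y. lin (\<lambda>z. f x y z)"
  shows "sw a (\<lambda>x y. sw x (\<lambda>x' x''. f x' x'' y)) = sw a (\<lambda>x y. sw y (\<lambda>y' y''. f x y' y''))"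
proof -
  note m = multilinear_3[of scale f, OF assms]
  note v = vector_space_axioms
  have p: "tensor_eval scale (\<lambda>w. f (w ! 0) (w ! 1) (w ! 2)) (pure scale [x, y, z]) = f x y z"
    for x y z
    using m by (subst tensor_eval_pure[OF v]) (simp_all add: numeral_3_eq_3)
  show ?thesis
    using arg_cong[OF coassoc[of a], of "tensor_eval scale (\<lambda>w. f (w ! 0) (w ! 1) (w ! 2))"]
    by (simp only: tensor_eval_sweedler_tensor[OF v m] p)
qed

lemma tensor_eval_pure_2:
  assumes "bilinear scale e"
  shows "tensor_eval scale (\<lambda>w. e (w ! 0) (w ! 1)) (pure scale [x, y]) = e x y"
  using multilinear_2[OF assms]
  by (subst tensor_eval_pure[OF vector_space_axioms]) (simp_all add: numeral_2_eq_2)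

lemma sweedler_mult:
  assumes "bilinear scale e"
  shows "sw (a * b) e = sw a (\<lambda>x y. sw b (\<lambda>z t. e (x * z) (y * t)))"
  \<comment> \<open>Only the sum over \<open>\<Delta> (a * b)\<close> is opened; the sums over
    \<open>\<Delta> a\<close> and \<open>\<Delta> b\<close> stay folded.\<close>
  unfolding sweedler_def[of _ "\<Delta> (a * b)"]
  unfolding Delta_mult
  by (simp only: tensor_eval_pure_2[OF assms]
      tensor_eval_sweedler_tensor[OF vector_space_axioms multilinear_2[OF assms]])

section \<open>The antipode\<close>

context
  fixes S
  assumes antipode: "is_antipode scale \<Delta> \<epsilon> S"
begin

lemma antipode_lin: "lin f \<Longrightarrow> lin (\<lambda>x. S (f x))"
  by (rule lin_comp[of S]) (use antipode in \<open>simp_all add: is_antipode_def\<close>)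

lemma antipode_left: "sw a (\<lambda>x y. S x * y) = scale (\<epsilon> a) 1"
  and antipode_right: "sw a (\<lambda>x y. x * S y) = scale (\<epsilon> a) 1"
  using antipode by (simp_all add: is_antipode_def)

text \<open>In the convolution algebra the hypothesis says that the identity convolved with
  \<open>h\<close> is \<open>k\<close>. Convolving with \<open>S\<close> on the left removes the
  identity, by associativity of convolution, which is coassociativity.\<close>

lemma convolution_cancel:
  assumes h: "lin h" and k: "\<And>a. sw a (\<lambda>x y. x * h y) = k a"
  shows "h a = sw a (\<lambda>x y. S x * k y)"
proof -
  have "h a = h (sw a (\<lambda>x y. scale (\<epsilon> x) y))"
    by (simp add: counit_left)
  also have "\<dots> = sw a (\<lambda>x y. scale (\<epsilon> x) 1 * h y)"
    by (simp add: linear_sweedler[OF h] lin_scale[OF h] scale_mult_left)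
  also have "\<dots> = sw a (\<lambda>x y. sw x (\<lambda>x' x''. S x' * x'' * h y))"
    by (simp add: antipode_left[symmetric] sweedler_mult_right)
  also have "\<dots> = sw a (\<lambda>x y. sw y (\<lambda>y' y''. S x * y' * h y''))"
    by (rule sweedler_coassoc) (intro lin_intros antipode_lin h)+
  also have "\<dots> = sw a (\<lambda>x y. S x * k y)"
    by (simp add: k[symmetric] sweedler_mult_left mult.assoc)
  finally show ?thesis .
qed

lemma convolution_cancel_counit:
  assumes "lin h" and "\<And>a. sw a (\<lambda>x y. x * h y) = scale (\<epsilon> a) c"
  shows "h a = S a * c"
proof -
  have l: "lin (\<lambda>x. S x * c)"
    by (intro lin_intros antipode_lin)
  have "h a = sw a (\<lambda>x y. S x * scale (\<epsilon> y) c)"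
    by (rule convolution_cancel[OF assms])
  also have "\<dots> = S (sw a (\<lambda>x y. scale (\<epsilon> y) x)) * c"
    by (simp add: linear_sweedler[OF l] lin_scale[OF l] scale_mult_right)
  finally show ?thesis
    by (simp add: counit_right)
qed

text \<open>The convolution in the two variables is inverted one variable at a time.\<close>

lemma antipode_mult: "S (a * b) = S a * S b"
proof -
  \<comment> \<open>Multiplicativity of \<Delta> identifies this double sum with the antipode axiom
    at \<open>x * b\<close>, and the counit of that product splits.\<close>
  have "sw x (\<lambda>x1 x2. x1 * sw b (\<lambda>z t. z * S (x2 * t))) = scale (\<epsilon> x) (scale (\<epsilon> b) 1)" for x b
  proof -
    have "sw x (\<lambda>x1 x2. x1 * sw b (\<lambda>z t. z * S (x2 * t))) = sw (x * b) (\<lambda>x y. x * S y)"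
      by (subst sweedler_mult)
        (intro lin_intros antipode_lin | simp add: sweedler_mult_left mult.assoc)+
    then show ?thesis
      by (simp add: antipode_right counit_mult)
  qed
  then have "sw b (\<lambda>z t. z * S (x * t)) = S x * scale (\<epsilon> b) 1" for x b
    by (intro convolution_cancel_counit lin_intros antipode_lin)
  then have "sw b (\<lambda>z t. z * S (a * t)) = scale (\<epsilon> b) (S a)" for b
    by (simp add: scale_mult_right)
  \<comment> \<open>The variable \<open>a\<close> is already inverted; the second cancellation is in
    \<open>b\<close>, with \<open>S (a * t)\<close> as a function of \<open>t\<close> and constant
    \<open>S a\<close>.\<close>
  then have "S (a * b) = S b * S a"
    by (intro convolution_cancel_counit lin_intros antipode_lin)
  then show ?thesis
    by (simp add: mult.commute)
qed

end

end

section \<open>The preLie product against the counit and the antipode\<close>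

context com_prelie_bialgebra
begin

lemma lin_pl_left: "lin f \<Longrightarrow> lin (\<lambda>x. f x \<bullet> c)"
  by (rule lin_comp[OF pl_linear_left])

lemma lin_pl_right: "lin f \<Longrightarrow> lin (\<lambda>x. c \<bullet> f x)"
  by (rule lin_comp[OF pl_linear_right])

lemmas pl_lin_intros = lin_intros lin_pl_left lin_pl_right

lemma sweedler_pl:
  assumes "bilinear scale e"
  shows "sw (a \<bullet> b) e =
    sw a (\<lambda>x y. e x (y \<bullet> b)) + sw a (\<lambda>x y. sw b (\<lambda>z t. e (x \<bullet> z) (y * t)))"
  unfolding sweedler_def[of _ "\<Delta> (a \<bullet> b)"]
  unfolding Delta_pl tensor_eval_add[OF vector_space_axioms multilinear_2[OF assms]]
  by (simp only: tensor_eval_pure_2[OF assms]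
      tensor_eval_sweedler_tensor[OF vector_space_axioms multilinear_2[OF assms]])

text \<open>The Leibniz identity for 1 = 1 * 1 yields two copies of \<open>1 \<bullet> c\<close>,
  one of which cancels.\<close>

lemma one_pl: "1 \<bullet> c = 0"
  using leibniz[of 1 1 c] by simp

text \<open>Apply the counit to the right factor of \<open>\<Delta> (a \<bullet> b)\<close>. The
  second term of \<open>Delta_pl\<close> alone returns \<open>a \<bullet> b\<close>, so the first
  contributes zero; applying the counit to what remains of it gives the claim.\<close>

lemma counit_pl: "\<epsilon> (a \<bullet> b) = 0"
proof -
  \<comment> \<open>The counit is followed by the unit map because \<open>linear_sweedler\<close>
    concerns maps from the algebra to itself.\<close>
  let ?e = "\<lambda>u. scale (\<epsilon> u) 1"
  have e: "lin ?e"
    by (intro pl_lin_intros)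
  have "a \<bullet> b = sw (a \<bullet> b) (\<lambda>x y. scale (\<epsilon> y) x)"
    by (simp add: counit_right)
  also have "\<dots> = sw a (\<lambda>x y. scale (\<epsilon> (y \<bullet> b)) x) +
      sw a (\<lambda>x y. sw b (\<lambda>z t. scale (\<epsilon> (y * t)) (x \<bullet> z)))"
    by (rule sweedler_pl) (intro pl_lin_intros)
  also have "sw a (\<lambda>x y. sw b (\<lambda>z t. scale (\<epsilon> (y * t)) (x \<bullet> z))) = a \<bullet> b"
  proof -
    have "sw b (\<lambda>z t. scale (\<epsilon> (y * t)) (x \<bullet> z)) = scale (\<epsilon> y) x \<bullet> b" for x y
    proof -
      have l: "lin (\<lambda>u. scale (\<epsilon> y) x \<bullet> u)"
        by (rule pl_linear_right)
      show ?thesis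
        using linear_sweedler[OF l, of "\<Delta> b" "\<lambda>z t. scale (\<epsilon> t) z"]
        by (simp add: counit_right lin_scale[OF pl_linear_right] lin_scale[OF pl_linear_left] counit_mult
            mult.commute)
    qed
    then show ?thesis
      using linear_sweedler[OF pl_linear_left[of b], of "\<Delta> a" "\<lambda>x y. scale (\<epsilon> y) x"]
      by (simp add: counit_right)
  qed
  finally have "sw a (\<lambda>x y. scale (\<epsilon> (y \<bullet> b)) x) = 0"
    by simp
  then have "0 = ?e (sw a (\<lambda>x y. scale (\<epsilon> (y \<bullet> b)) x))"
    by (simp add: counit_scale[of 0 0, simplified])
  \<comment> \<open>The scalars \<open>\<epsilon> x\<close> and
    \<open>\<epsilon> (y \<bullet> b)\<close> commute, so the counit can be made to act on the left
    factor of \<open>\<Delta> a\<close> instead.\<close>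
  also have "\<dots> = ?e (sw a (\<lambda>x y. scale (\<epsilon> x) y) \<bullet> b)"
  proof -
    have l: "lin (\<lambda>u. ?e (u \<bullet> b))"
      by (intro pl_lin_intros)
    show ?thesis
      unfolding linear_sweedler[OF e] linear_sweedler[OF l]
      by (simp add: lin_scale[OF pl_linear_left] counit_scale mult.commute)
  qed
  finally have "scale (\<epsilon> (a \<bullet> b)) 1 = 0"
    by (simp add: counit_left)
  \<comment> \<open>A second counit recovers the scalar, as \<epsilon> of 1 is 1. Zero is written
    \<open>scale 0 0\<close> so that \<open>counit_scale\<close> applies on the right too.\<close>
  then have "\<epsilon> (scale (\<epsilon> (a \<bullet> b)) 1) = \<epsilon> (scale 0 0)"
    by simp
  then show ?thesis
    unfolding counit_scale counit_one by simp
qed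

lemma antipode_pl:
  assumes antipode: "is_antipode scale \<Delta> \<epsilon> S"
  shows "S (a \<bullet> b) = sw b (\<lambda>x y. (S a \<bullet> x) * S y)"
proof -
  note intros = pl_lin_intros antipode_lin[OF antipode]
  let ?k = "\<lambda>a. - sw a (\<lambda>x y. sw b (\<lambda>z t. (x \<bullet> z) * (S y * S t)))"
  \<comment> \<open>The antipode axiom at \<open>a \<bullet> b\<close> has right side zero by
    \<open>counit_pl\<close>, and \<open>antipode_mult\<close> splits
    \<open>S (y * t)\<close>.\<close>
  have k: "sw a (\<lambda>x y. x * S (y \<bullet> b)) = ?k a" for a
  proof -
    have "0 = sw (a \<bullet> b) (\<lambda>x y. x * S y)"
      by (simp add: antipode_right[OF antipode] counit_pl)
    also have "\<dots> = sw a (\<lambda>x y. x * S (y \<bullet> b)) +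
        sw a (\<lambda>x y. sw b (\<lambda>z t. (x \<bullet> z) * S (y * t)))"
      by (rule sweedler_pl) (intro intros)
    finally show ?thesis
      by (simp add: antipode_mult[OF antipode] eq_neg_iff_add_eq_0)
  qed
  have leibniz_antipode: "- sw a (\<lambda>x y. S x * (y \<bullet> c)) = sw a (\<lambda>x y. (S x \<bullet> c) * y)" for a c
  proof -
    have "sw a (\<lambda>x y. S x * (y \<bullet> c)) + sw a (\<lambda>x y. (S x \<bullet> c) * y) = sw a (\<lambda>x y. S x * y) \<bullet> c"
      by (simp add: linear_sweedler[OF pl_linear_left] leibniz sweedler_add)
    also have "\<dots> = 0"
      by (simp add: antipode_left[OF antipode] lin_scale[OF pl_linear_left] one_pl)
    finally show ?thesis
      by (rule minus_unique)
  qed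
  \<comment> \<open>For fixed \<open>z\<close>, coassociativity is used twice: first to group the
    two factors that \<open>leibniz_antipode\<close> rewrites, then to group the last two into an
    antipode axiom.\<close>
  have cancel: "sw a (\<lambda>x y. sw y (\<lambda>y' y''. - (S x * (y' \<bullet> z) * S y''))) = S a \<bullet> z" for z
  proof -
    have l: "lin (\<lambda>u. S u \<bullet> z)"
      by (intro intros)
    have "sw a (\<lambda>x y. sw y (\<lambda>y' y''. - (S x * (y' \<bullet> z) * S y''))) =
        sw a (\<lambda>x y. sw x (\<lambda>x' x''. - (S x' * (x'' \<bullet> z) * S y)))"
      by (rule sweedler_coassoc[symmetric]) (intro intros)+
    also have "\<dots> = sw a (\<lambda>x y. (- sw x (\<lambda>x' x''. S x' * (x'' \<bullet> z))) * S y)"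
      by (simp add: sweedler_uminus sweedler_mult_right)
    also have "\<dots> = sw a (\<lambda>x y. sw x (\<lambda>x' x''. (S x' \<bullet> z) * x'' * S y))"
      by (simp only: leibniz_antipode sweedler_mult_right)
    also have "\<dots> = sw a (\<lambda>x y. sw y (\<lambda>y' y''. (S x \<bullet> z) * y' * S y''))"
      by (rule sweedler_coassoc) (intro intros)+
    also have "\<dots> = sw a (\<lambda>x y. (S x \<bullet> z) * sw y (\<lambda>y' y''. y' * S y''))"
      by (simp add: sweedler_mult_left mult.assoc)
    also have "\<dots> = S (sw a (\<lambda>x y. scale (\<epsilon> y) x)) \<bullet> z"
      by (simp add: antipode_right[OF antipode] scale_mult_right linear_sweedler[OF l] lin_scale[OF l])
    finally show ?thesis
      by (simp add: counit_right)
  qed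
  \<comment> \<open>The cancelled map is \<open>S (a \<bullet> b)\<close> as a function of
    \<open>a\<close>, with \<open>b\<close> fixed.\<close>
  have "S (a \<bullet> b) = sw a (\<lambda>x y. S x * ?k y)"
    by (rule convolution_cancel[OF antipode _ k]) (intro intros)
  also have "\<dots> = sw a (\<lambda>x y. sw y (\<lambda>y' y''. sw b (\<lambda>z t. - (S x * (y' \<bullet> z) * S y'') * S t)))"
    by (simp add: sweedler_mult_left sweedler_uminus mult.assoc)
  \<comment> \<open>With the sum over \<open>\<Delta> b\<close> outermost, \<open>z\<close> is
    constant in the inner sums and \<open>cancel\<close> applies to each summand.\<close>
  also have "\<dots> = sw b (\<lambda>z t. sw a (\<lambda>x y. sw y (\<lambda>y' y''. - (S x * (y' \<bullet> z) * S y''))) * S t)"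
    by (simp only: sweedler_swap[of _ "\<Delta> b"] sweedler_mult_right)
  finally show ?thesis
    by (simp only: cancel)
qed

end

theorem theorem1p3:
  fixes scale :: "'k::field_char_0 \<Rightarrow> 'a::comm_ring_1 \<Rightarrow> 'a"
    and pl :: "'a \<Rightarrow> 'a \<Rightarrow> 'a"  (infixl \<open>\<bullet>\<close> 70)
    and \<Delta> :: "'a \<Rightarrow> ('a, 'k) tensor"
    and \<epsilon> :: "'a \<Rightarrow> 'k"
    and S :: "'a \<Rightarrow> 'a"
  assumes "com_prelie_bialgebra scale pl \<Delta> \<epsilon>"
    and "conilpotent scale \<Delta> \<epsilon>"
    and "is_antipode scale \<Delta> \<epsilon> S"
  shows "\<forall>a b. S (a \<bullet> b) = sweedler scale (\<Delta> b) (\<lambda>x y. (S a \<bullet> x) * S y)"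
  using com_prelie_bialgebra.antipode_pl[OF assms(1,3)] by blast

end
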